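(* There exists a weakly Radon-Nikod\'ym (WRN) Boolean algebra which is not minimally generated.
   Context: A family $\{a_i:i\in I\}$ in a Boolean algebra is independent if $\bigcap_{i\in I'}a_i\cap\bigcap_{i\in I''}a_i^c\neq 0$ for all finite disjoint $I',I''\subseteq I$. A Boolean algebra $\mathfrak A$ is weakly Radon-Nikod\'ym (WRN) if there is a family $\mathcal G\subseteq\mathfrak A$ generating $\mathfrak A$ such that $\mathcal G=\bigcup_{n}\mathcal G_n$ (countable union), where for every $n$ the family $\mathcal G_n$ contains no infinite independent sequence. If $\mathfrak B$ is a subalgebra of $\mathfrak A$ and $x\in\mathfrak A\setminus\mathfrak B$, let $\mathfrak B(x)$ be the subalgebra of $\mathfrak A$ generated by $\mathfrak B\cup\{x\}$. $\mathfrak B(x)$ is a minimal extension of $\mathfrak B$ if every algebra $\mathfrak C$ with $\mathfrak B\subseteq\mathfrak C\subseteq\mathfrak B(x)$ satisfies $\mathfrak C=\mathfrak B$ or $\mathfrak C=\mathfrak B(x)$. A Boolean algebra $\mathfrak A$ is minimally generated if, for some ordinal $\gamma$, $\mathfrak A=\bigcup_{\xi<\gamma}\mathfrak B_\xi$ is a continuous increasing union (i.e. $\mathfrak B_\eta=\bigcup_{\xi<\eta}\mathfrak B_\xi$ at limit $\eta$) of subalgebras where $\mathfrak B_0=\{0,1\}$ and each $\mathfrak B_{\xi+1}$ is a minimal extension of $\mathfrak B_\xi$. *)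

theory Defs
  imports Complex_Main
begin

(* A Boolean algebra is given by a carrier A that is closed under the operations of an ambient
   type of class boolean_algebra, so that algebras and subalgebras are treated uniformly.
   The whole ambient type is the case A = UNIV.  Every notion below applied to A depends only
   on A with the operations restricted to it, not on the ambient algebra. *)

definition boolean_subalgebra :: "'a::boolean_algebra set \<Rightarrow> bool" where
  "boolean_subalgebra A \<longleftrightarrow>
     bot \<in> A \<and> top \<in> A \<and> (\<forall>x\<in>A. - x \<in> A) \<and>
     (\<forall>x\<in>A. \<forall>y\<in>A. inf x y \<in> A) \<and> (\<forall>x\<in>A. \<forall>y\<in>A. sup x y \<in> A)"

abbreviation generated_subalgebra :: "'a::boolean_algebra set \<Rightarrow> 'a set" where
  "generated_subalgebra S \<equiv> boolean_subalgebra hull S"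

lemma boolean_subalgebra_UNIV: "boolean_subalgebra UNIV"
  by (simp add: boolean_subalgebra_def)

lemma boolean_subalgebra_generated: "boolean_subalgebra (generated_subalgebra S)"
  by (rule hull_in) (auto simp: boolean_subalgebra_def)

(* Inserting top makes Inf_fin return the correct value top for the empty family. *)
definition independent_family :: "'i set \<Rightarrow> ('i \<Rightarrow> 'a::boolean_algebra) \<Rightarrow> bool" where
  "independent_family I a \<longleftrightarrow>
     (\<forall>J K. finite J \<longrightarrow> finite K \<longrightarrow> J \<subseteq> I \<longrightarrow> K \<subseteq> I \<longrightarrow> J \<inter> K = {} \<longrightarrow>
        inf (Inf_fin (insert top (a ` J))) (Inf_fin (insert top ((\<lambda>i. - a i) ` K))) \<noteq> bot)"

definition weakly_Radon_Nikodym :: "'a::boolean_algebra set \<Rightarrow> bool" where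
  "weakly_Radon_Nikodym A \<longleftrightarrow>
     boolean_subalgebra A \<and>
     (\<exists>G :: nat \<Rightarrow> 'a set.
        (\<forall>n. G n \<subseteq> A) \<and> generated_subalgebra (\<Union>n. G n) = A \<and>
        (\<forall>n. \<not> (\<exists>s :: nat \<Rightarrow> 'a. range s \<subseteq> G n \<and> independent_family UNIV s)))"

definition minimal_extension :: "'a::boolean_algebra set \<Rightarrow> 'a set \<Rightarrow> bool" where
  "minimal_extension B E \<longleftrightarrow>
     boolean_subalgebra B \<and>
     (\<exists>x. x \<notin> B \<and> E = generated_subalgebra (insert x B)) \<and>
     (\<forall>C. boolean_subalgebra C \<longrightarrow> B \<subseteq> C \<longrightarrow> C \<subseteq> E \<longrightarrow> C = B \<or> C = E)"

definition immediate_succ :: "'i rel \<Rightarrow> 'i \<Rightarrow> 'i \<Rightarrow> bool" where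
  "immediate_succ r i j \<longleftrightarrow>
     (i, j) \<in> r \<and> i \<noteq> j \<and> (\<forall>k. (i, k) \<in> r \<and> k \<noteq> i \<longrightarrow> (j, k) \<in> r)"

(* The ordinal \<gamma> is represented by a well-order r, whose field plays the role of {\<xi>. \<xi> < \<gamma>}.
   Taking the indices in 'a set loses no ordinal: the B \<xi> are pairwise distinct, because
   minimal extensions are proper, so \<xi> \<mapsto> B \<xi> injects the indices into 'a set. *)
definition minimally_generated :: "'a::boolean_algebra set \<Rightarrow> bool" where
  "minimally_generated A \<longleftrightarrow>
     boolean_subalgebra A \<and>
     (\<exists>(r :: 'a set rel) (B :: 'a set \<Rightarrow> 'a set).
        Well_order r \<and>
        A = (\<Union>i\<in>Field r. B i) \<and>
        (\<forall>i\<in>Field r. boolean_subalgebra (B i)) \<and>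
        (\<forall>i j. (i, j) \<in> r \<longrightarrow> B i \<subseteq> B j) \<and>
        (\<forall>i\<in>Field r. underS r i = {} \<longrightarrow> B i = {bot, top}) \<and>
        (\<forall>i j. immediate_succ r i j \<longrightarrow> minimal_extension (B i) (B j)) \<and>
        (\<forall>j\<in>Field r. underS r j \<noteq> {} \<and> (\<nexists>i. immediate_succ r i j) \<longrightarrow>
           B j = (\<Union>i\<in>underS r j. B i)))"

end

theory Submission
  imports Defs "HOL-Analysis.Abstract_Topology_2" "HOL-Library.Nat_Bijection"
begin

text \<open>
  Call a set \<open>T\<close> of nonzero elements of a Boolean algebra a dense tree if any two members of \<open>T\<close>
  are comparable or disjoint and every nonzero element of the algebra lies above a member of \<open>T\<close>.
  The proof separates the two classes of algebras by this notion.

  Every minimally generated algebra has a dense tree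
  (\<open>minimally_generated_dense_tree\<close>): in a minimal extension exactly one ultrafilter of the
  smaller algebra is split, so a new element with nothing old below it can only sit at that
  ultrafilter and therefore contains an atom of the extension. Hence the elements that are atoms of
  some stage of the construction are dense, and they form a tree because an atom of a stage cannot
  be cut by any element of an earlier stage.

  The counterexample is the algebra of subsets of \<open>X \<times> Y\<close> generated by two kinds of cylinders.
  Here \<open>X\<close> is the set of countable subsets of \<open>\<omega>\<^sub>1\<close>, its cylinders
  prescribe a subset below some \<open>\<alpha> < \<omega>\<^sub>1\<close>, and \<open>Y\<close> is the Cantor space of subsets of \<open>\<nat>\<close>,
  whose cylinders prescribe one bit. The cylinders of the first kind are pairwise comparable or
  disjoint, so no two of them are independent; the second kind is a countable family,
  a union of singletons. So the algebra is WRN (\<open>weakly_Radon_Nikodym_alg\<close>).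

  It has no dense tree (\<open>no_dense_tree\<close>), for the reason that the forcing notion which it
  represents is the product of a countably closed one and Cohen forcing. Along a decreasing
  \<open>\<omega>\<close>-sequence in \<open>X\<close>, every finite word in \<open>Y\<close> can be visited and a tree element placed below it.
  Countable closure gives a limit of the sequence, and a tree element \<open>t\<close> over that limit has some word
  \<open>w\<close> in its \<open>Y\<close>-part. The tree element \<open>u\<close> chosen for a proper extension of \<open>w\<close> meets \<open>t\<close>,
  is narrower than \<open>t\<close> in the direction of \<open>Y\<close> and wider in the direction of \<open>X\<close>, which is impossible
  in a tree.

  There are only continuum many pairs of a countable subset of \<open>\<omega>\<^sub>1\<close> and a subset of \<open>\<nat>\<close>, so the points
  of \<open>X \<times> Y\<close> can be coded by real numbers.
\<close>

section \<open>Minimal extensions\<close>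

lemma generated_insert:
  fixes B :: "'a::boolean_algebra set"
  assumes B: "boolean_subalgebra B" and e: "e \<in> generated_subalgebra (insert x B)"
  obtains c d where "c \<in> B" "d \<in> B" "e = sup (inf c x) (inf d (- x))"
proof -
  let ?m = "\<lambda>c d. sup (inf c x) (inf d (- x))"
  let ?E = "{?m c d | c d. c \<in> B \<and> d \<in> B}"
  have bot: "bot \<in> B" and top: "top \<in> B" and compl: "\<And>c. c \<in> B \<Longrightarrow> - c \<in> B"
    and inf: "\<And>c d. c \<in> B \<Longrightarrow> d \<in> B \<Longrightarrow> inf c d \<in> B"
    and sup: "\<And>c d. c \<in> B \<Longrightarrow> d \<in> B \<Longrightarrow> sup c d \<in> B"
    using B by (auto simp: boolean_subalgebra_def)
  have meet: "inf (?m c d) (?m c' d') = ?m (inf c c') (inf d d')" for c d c' d'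
    by (simp add: inf_sup_distrib1 inf_sup_distrib2 inf.assoc inf.left_commute inf.commute)
  have join: "sup (?m c d) (?m c' d') = ?m (sup c c') (sup d d')" for c d c' d'
    by (simp add: inf_sup_distrib1 inf_sup_distrib2 sup.assoc sup.left_commute sup.commute)
  have neg: "- ?m c d = ?m (- c) (- d)" for c d
    by (rule compl_unique) (simp_all only: meet join, simp_all)
  have diag: "?m b b = b" for b
    by (simp flip: inf_sup_distrib1)
  have mem: "b \<in> ?E" if "b \<in> B" for b
    using that diag[of b, symmetric] by blast
  have "boolean_subalgebra ?E"
    unfolding boolean_subalgebra_def
  proof (intro conjI ballI)
    show "bot \<in> ?E" "top \<in> ?E" using mem bot top by blast+
  next
    fix u assume "u \<in> ?E"
    then obtain c d where "c \<in> B" "d \<in> B" "u = ?m c d" by blast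
    then show "- u \<in> ?E" using compl neg[of c d] by blast
  next
    fix u v assume "u \<in> ?E" "v \<in> ?E"
    then obtain c d c' d' where *: "c \<in> B" "d \<in> B" "u = ?m c d" "c' \<in> B" "d' \<in> B" "v = ?m c' d'"
      by blast
    show "inf u v \<in> ?E" using * inf meet[of c d c' d'] by blast
    show "sup u v \<in> ?E" using * sup join[of c d c' d'] by blast
  qed
  moreover have "x \<in> ?E"
  proof -
    have "x = ?m top bot" by simp
    then show ?thesis using top bot by blast
  qed
  ultimately have "e \<in> ?E"
    using e hull_minimal[of "insert x B" ?E boolean_subalgebra] mem by blast
  then show thesis using that by blast
qed

text \<open>
  The elements \<open>c\<close> of \<open>B\<close> with \<open>inf x c \<in> B\<close>, where \<open>x\<close> generates the extension, form an ideal.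
  By minimality it is maximal: if neither \<open>c\<close> nor \<open>- c\<close> belonged to it, then adjoining \<open>inf x c\<close>
  would give an algebra strictly between \<open>B\<close> and \<open>E\<close>. Dually, only one ultrafilter of \<open>B\<close> splits.
\<close>

lemma minimal_extension_meet:
  fixes B :: "'a::boolean_algebra set"
  assumes ext: "minimal_extension B E" and y: "y \<in> E" and c: "c \<in> B"
  shows "inf y c \<in> B \<or> inf y (- c) \<in> B"
proof -
  obtain x where E: "E = generated_subalgebra (insert x B)"
    using ext by (auto simp: minimal_extension_def)
  have B: "boolean_subalgebra B" using ext by (simp add: minimal_extension_def)
  have compl: "\<And>c. c \<in> B \<Longrightarrow> - c \<in> B"
    and inf: "\<And>c d. c \<in> B \<Longrightarrow> d \<in> B \<Longrightarrow> inf c d \<in> B"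
    and sup: "\<And>c d. c \<in> B \<Longrightarrow> d \<in> B \<Longrightarrow> sup c d \<in> B"
    using B by (auto simp: boolean_subalgebra_def)
  have x: "inf x c \<in> B \<or> inf x (- c) \<in> B"
  proof (cases "inf x c \<in> B")
    case False
    let ?z = "inf x c"
    let ?C = "generated_subalgebra (insert ?z B)"
    have sub: "insert ?z B \<subseteq> ?C" by (rule hull_subset)
    have E_alg: "boolean_subalgebra E" and xE: "insert x B \<subseteq> E"
      unfolding E by (rule boolean_subalgebra_generated, rule hull_subset)
    have "?z \<in> E"
      using E_alg xE c by (auto simp: boolean_subalgebra_def)
    then have "?C \<subseteq> E"
      using hull_minimal[of "insert ?z B" E boolean_subalgebra] E_alg xE by blast
    then have "?C = B \<or> ?C = E"
      using ext sub boolean_subalgebra_generated[of "insert ?z B"]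
      unfolding minimal_extension_def by blast
    then have "x \<in> ?C" using False sub xE by blast
    then obtain a b where ab: "a \<in> B" "b \<in> B" "x = sup (inf a ?z) (inf b (- ?z))"
      using generated_insert[OF B] by metis
    \<comment> \<open>Outside \<open>c\<close> the new element \<open>?z\<close> vanishes, so \<open>x\<close> agrees there with \<open>b\<close>.\<close>
    have "inf x (- c) = inf (sup (inf a ?z) (inf b (- ?z))) (- c)"
      using ab(3) by simp
    also have "\<dots> = inf b (- c)"
    proof -
      have "inf x (inf c (- c)) = bot" by simp
      moreover have "inf (- ?z) (- c) = - c"
        by (simp add: inf_absorb2)
      ultimately show ?thesis
        by (simp only: inf_sup_distrib2 inf_assoc inf_bot_right sup_bot_left)
    qed
    finally show ?thesis using ab(2) c compl inf by simp
  qed simp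
  obtain a d where ad: "a \<in> B" "d \<in> B" "y = sup (inf a x) (inf d (- x))"
    using generated_insert[OF B, of y x] y E by metis
  have key: "inf y e \<in> B" if "inf x e \<in> B" "e \<in> B" for e
  proof -
    have "inf y e = sup (inf a (inf x e)) (inf (inf d e) (- inf x e))"
      unfolding ad(3)
      by (simp add: inf_sup_distrib1 inf_sup_distrib2 inf.assoc inf.left_commute inf.commute)
    moreover have "\<dots> \<in> B" by (intro sup inf compl ad(1,2) that)
    ultimately show ?thesis by simp
  qed
  show ?thesis using x key[of c] key[of "- c"] c compl by blast
qed

definition atom_in :: "'a::boolean_algebra set \<Rightarrow> 'a \<Rightarrow> bool" where
  "atom_in C y \<longleftrightarrow> y \<in> C \<and> y \<noteq> bot \<and> (\<forall>c\<in>C. inf y c = bot \<or> inf y c = y)"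

text \<open>
  An element \<open>y\<close> above no nonzero element of \<open>B\<close> is not cut by any element of \<open>B\<close>, so the generator
  \<open>x\<close> is the only thing that can cut it, and each nonzero part \<open>inf y x\<close> or \<open>inf y (- x)\<close>
  is an atom of \<open>E\<close>.
\<close>

lemma minimal_extension_atom:
  fixes B :: "'a::boolean_algebra set"
  assumes ext: "minimal_extension B E" and y: "y \<in> E" "y \<noteq> bot"
    and none: "\<And>b. b \<in> B \<Longrightarrow> b \<le> y \<Longrightarrow> b = bot"
  obtains z where "z \<le> y" "atom_in E z"
proof -
  obtain x where E: "E = generated_subalgebra (insert x B)"
    using ext by (auto simp: minimal_extension_def)
  have B: "boolean_subalgebra B" using ext by (simp add: minimal_extension_def)
  have alg: "boolean_subalgebra E" unfolding E by (rule boolean_subalgebra_generated)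
  have "x \<in> E" unfolding E by (rule hull_inc) simp
  have dich: "inf y c = bot \<or> inf y c = y" if "c \<in> B" for c
  proof -
    have "inf y c = bot \<or> inf y (- c) = bot"
      using minimal_extension_meet[OF ext y(1) that] none by fastforce
    moreover have "y = sup (inf y c) (inf y (- c))"
      by (simp flip: inf_sup_distrib1)
    ultimately show ?thesis by (metis sup_bot_right)
  qed
  have atom: "atom_in E (inf y w)" if w: "w = x \<or> w = - x" and nz: "inf y w \<noteq> bot" for w
    unfolding atom_in_def
  proof (intro conjI ballI)
    show "inf y w \<in> E"
      using alg y(1) \<open>x \<in> E\<close> w by (auto simp: boolean_subalgebra_def)
    show "inf y w \<noteq> bot" by (rule nz)
    fix e assume "e \<in> E"
    then obtain c d where cd: "c \<in> B" "d \<in> B" "e = sup (inf c x) (inf d (- x))"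
      using generated_insert[OF B] E by metis
    have "\<exists>b\<in>B. inf w e = inf w b"
      using w
    proof
      assume "w = x"
      then have "inf w e = inf w c"
        unfolding cd(3) by (simp add: inf_sup_distrib1 inf.assoc inf.left_commute inf.commute)
      then show ?thesis using cd(1) by blast
    next
      assume "w = - x"
      then have "inf w e = inf w d"
        unfolding cd(3) by (simp add: inf_sup_distrib1 inf.assoc inf.left_commute inf.commute)
      then show ?thesis using cd(2) by blast
    qed
    then obtain b where b: "b \<in> B" "inf w e = inf w b" by blast
    have "inf (inf y w) e = inf (inf y b) w"
      using b(2) by (metis inf.assoc inf.commute)
    then show "inf (inf y w) e = bot \<or> inf (inf y w) e = inf y w"
      using dich[OF b(1)] by auto
  qed
  have "y = sup (inf y x) (inf y (- x))"
    by (simp flip: inf_sup_distrib1)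
  then have "inf y x \<noteq> bot \<or> inf y (- x) \<noteq> bot" using y(2) by force
  then show thesis using that[OF inf_le1 atom[of x]] that[OF inf_le1 atom[of "- x"]] by blast
qed

section \<open>Minimally generated algebras have a dense tree\<close>

definition dense_tree :: "'a::boolean_algebra set \<Rightarrow> 'a set \<Rightarrow> bool" where
  "dense_tree A T \<longleftrightarrow> T \<subseteq> A - {bot} \<and> (\<forall>s\<in>T. \<forall>t\<in>T. s \<le> t \<or> t \<le> s \<or> inf s t = bot) \<and>
     (\<forall>a\<in>A. a \<noteq> bot \<longrightarrow> (\<exists>t\<in>T. t \<le> a))"

lemma dense_treeD:
  assumes "dense_tree A T"
  shows "\<And>t. t \<in> T \<Longrightarrow> t \<in> A" "\<And>t. t \<in> T \<Longrightarrow> t \<noteq> bot"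
    "\<And>s t. s \<in> T \<Longrightarrow> t \<in> T \<Longrightarrow> s \<le> t \<or> t \<le> s \<or> inf s t = bot"
    "\<And>a. a \<in> A \<Longrightarrow> a \<noteq> bot \<Longrightarrow> \<exists>t\<in>T. t \<le> a"
  using assms by (auto simp: dense_tree_def)

text \<open>
  The tree consists of the atoms of all stages. For density, look at the first stage that has a nonzero
  element below the given one. It is not a limit stage; the initial stage has the atom \<open>top\<close>, and at a
  successor stage \<open>minimal_extension_atom\<close> applies.
\<close>

lemma minimally_generated_dense_tree:
  fixes A :: "'a::boolean_algebra set"
  assumes "minimally_generated A"
  obtains T where "dense_tree A T"
proof -
  obtain r :: "'a set rel" and B where r: "Well_order r"
    and A: "A = (\<Union>i\<in>Field r. B i)"
    and alg: "\<forall>i\<in>Field r. boolean_subalgebra (B i)"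
    and mono: "\<forall>i j. (i, j) \<in> r \<longrightarrow> B i \<subseteq> B j"
    and zero: "\<forall>i\<in>Field r. underS r i = {} \<longrightarrow> B i = {bot, top}"
    and succ: "\<forall>i j. immediate_succ r i j \<longrightarrow> minimal_extension (B i) (B j)"
    and lim: "\<forall>j\<in>Field r. underS r j \<noteq> {} \<and> (\<nexists>i. immediate_succ r i j) \<longrightarrow>
           B j = (\<Union>i\<in>underS r j. B i)"
    using assms unfolding minimally_generated_def by (elim conjE exE) blast
  have wf: "wf (r - Id)"
    using r by (simp add: well_order_on_def)
  let ?T = "{y. \<exists>i\<in>Field r. atom_in (B i) y}"
  have "?T \<subseteq> A - {bot}"
    unfolding A by (auto simp: atom_in_def)
  moreover have "\<forall>s\<in>?T. \<forall>t\<in>?T. s \<le> t \<or> t \<le> s \<or> inf s t = bot"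
  proof (intro ballI)
    fix s t assume "s \<in> ?T" "t \<in> ?T"
    then obtain i j where ij: "i \<in> Field r" "j \<in> Field r" "atom_in (B i) s" "atom_in (B j) t"
      by blast
    have *: "t \<le> s \<or> inf t s = bot" if "s \<in> B j" "atom_in (B j) t" for s t j
      using that by (auto simp: atom_in_def le_iff_inf)
    consider "B i \<subseteq> B j" | "B j \<subseteq> B i"
      using mono ij(1,2) wo_rel.TOTALS[OF wo_rel.intro[OF r]] by blast
    then show "s \<le> t \<or> t \<le> s \<or> inf s t = bot"
    proof cases
      case 1
      then show ?thesis using *[of s j t] ij by (auto simp: atom_in_def inf_commute)
    next
      case 2
      then show ?thesis using *[of t i s] ij by (auto simp: atom_in_def inf_commute)
    qed
  qed
  moreover have "\<exists>t\<in>?T. t \<le> a" if a: "a \<in> A" "a \<noteq> bot" for a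
  proof -
    define Q where "Q = {i \<in> Field r. \<exists>y\<in>B i. y \<noteq> bot \<and> y \<le> a}"
    have "Q \<noteq> {}" using a unfolding A Q_def by blast
    then obtain j where j: "j \<in> Q" and least: "\<forall>i. (i, j) \<in> r - Id \<longrightarrow> i \<notin> Q"
      using wf unfolding wf_eq_minimal by (metis ex_in_conv)
    have jF: "j \<in> Field r" using j by (simp add: Q_def)
    have least': "\<not> (\<exists>y\<in>B i. y \<noteq> bot \<and> y \<le> a)" if "i \<in> underS r j" for i
      using least that by (auto simp: Q_def underS_def Field_def)
    obtain y where y: "y \<in> B j" "y \<noteq> bot" "y \<le> a" using j by (auto simp: Q_def)
    show ?thesis
    proof (cases "underS r j = {}")
      case True
      then have "B j = {bot, top}" using zero jF by blast
      then have "atom_in (B j) y" using y by (auto simp: atom_in_def)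
      then show ?thesis using jF y(3) by blast
    next
      case False
      have "B j \<noteq> (\<Union>i\<in>underS r j. B i)" using y least' by blast
      then obtain i where i: "immediate_succ r i j" using lim False jF by blast
      then have "i \<in> underS r j" by (auto simp: immediate_succ_def underS_def)
      then have "b = bot" if "b \<in> B i" "b \<le> y" for b
        using least' that y(3) order_trans by blast
      then obtain z where "z \<le> y" "atom_in (B j) z"
        using minimal_extension_atom[OF _ y(1,2)] succ i by metis
      then show ?thesis using jF y(3) order_trans by blast
    qed
  qed
  ultimately have "dense_tree A ?T" unfolding dense_tree_def by blast
  then show thesis by (rule that)
qed

section \<open>The product of a countably closed tree and the Cantor set\<close>

lemma independent_family_pair:
  fixes a :: "'i \<Rightarrow> 'a::boolean_algebra"
  assumes "independent_family UNIV a" "i \<noteq> j"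
  shows "inf (a i) (a j) \<noteq> bot" "inf (a i) (- a j) \<noteq> bot"
proof -
  have *: "inf (Inf_fin (insert top (a ` J))) (Inf_fin (insert top ((\<lambda>i. - a i) ` K))) \<noteq> bot"
    if "finite J" "finite K" "J \<inter> K = {}" for J K
    using assms(1) that by (simp add: independent_family_def)
  show "inf (a i) (a j) \<noteq> bot" using *[of "{i, j}" "{}"] by simp
  show "inf (a i) (- a j) \<noteq> bot" using *[of "{i}" "{j}"] assms(2) by simp
qed

lemma Int_eq_Int_mono: "A \<inter> D = B \<inter> D \<Longrightarrow> C \<subseteq> D \<Longrightarrow> A \<inter> C = B \<inter> C"
  by (auto simp: set_eq_iff)

text \<open>
  The map \<open>p \<mapsto> (\<sigma> p, \<tau> p)\<close> codes all pairs of a countable subset of the index type and a set of natural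
  numbers; it need not be injective. The index set \<open>W\<close> plays the role of \<open>\<omega>\<^sub>1\<close>, and \<open>below \<alpha>\<close> that
  of the initial segment of \<open>\<alpha>\<close>. Assumption \<open>bound\<close> is uncountable cofinality; it provides
  lower bounds for decreasing sequences of cylinders \<open>seg \<alpha> S\<close>.
\<close>

locale tree_times_cantor =
  fixes W :: "'w set" and below :: "'w \<Rightarrow> 'w set"
    and \<sigma> :: "'p \<Rightarrow> 'w set" and \<tau> :: "'p \<Rightarrow> nat set"
  assumes irrefl: "\<alpha> \<notin> below \<alpha>"
    and linear: "\<alpha> \<in> W \<Longrightarrow> \<beta> \<in> W \<Longrightarrow> below \<alpha> \<subseteq> below \<beta> \<or> below \<beta> \<subseteq> below \<alpha>"
    and bound: "countable S \<Longrightarrow> S \<subseteq> W \<Longrightarrow>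
      \<exists>\<beta>\<in>W. S \<subseteq> below \<beta> \<and> (\<forall>\<alpha>\<in>S. below \<alpha> \<subseteq> below \<beta>)"
    and countable_\<sigma>: "countable (\<sigma> p)"
    and point: "countable S \<Longrightarrow> \<exists>p. \<sigma> p = S \<and> \<tau> p = F"
begin

definition seg :: "'w \<Rightarrow> 'w set \<Rightarrow> 'p set" where
  "seg \<alpha> S = {p. \<sigma> p \<inter> below \<alpha> = S \<inter> below \<alpha>}"

definition bit :: "nat \<Rightarrow> 'p set" where
  "bit n = {p. n \<in> \<tau> p}"

definition cyl :: "'w \<Rightarrow> 'w set \<Rightarrow> nat \<Rightarrow> nat set \<Rightarrow> 'p set" where
  "cyl \<alpha> S n F = {p \<in> seg \<alpha> S. \<tau> p \<inter> {..<n} = F \<inter> {..<n}}"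

text \<open>
  Only the first family is large. Each bit forms a family of its own, so that no sequence in it
  can be independent.
\<close>

definition gens :: "nat \<Rightarrow> 'p set set" where
  "gens k = (case k of 0 \<Rightarrow> {seg \<alpha> S | \<alpha> S. \<alpha> \<in> W} | Suc n \<Rightarrow> {bit n})"

definition alg :: "'p set set" where
  "alg = generated_subalgebra (\<Union>k. gens k)"

lemma boolean_alg: "boolean_subalgebra alg"
  unfolding alg_def by (rule boolean_subalgebra_generated)

lemma gens_alg: "gens k \<subseteq> alg"
  unfolding alg_def using hull_subset[of "\<Union>k. gens k" boolean_subalgebra] by blast

lemma seg_alg: "\<alpha> \<in> W \<Longrightarrow> seg \<alpha> S \<in> alg"
  using gens_alg[of 0] by (auto simp: gens_def)

lemma bit_alg: "bit n \<in> alg"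
  using gens_alg[of "Suc n"] by (simp add: gens_def)

lemma cyl_alg:
  assumes "\<alpha> \<in> W"
  shows "cyl \<alpha> S n F \<in> alg"
proof (induction n)
  case 0
  then show ?case using seg_alg[OF assms] by (simp add: cyl_def)
next
  case (Suc n)
  have "cyl \<alpha> S (Suc n) F = cyl \<alpha> S n F \<inter> (if n \<in> F then bit n else - bit n)"
    by (auto simp: cyl_def bit_def lessThan_Suc)
  then show ?case using Suc bit_alg[of n] boolean_alg by (simp add: boolean_subalgebra_def)
qed

text \<open>
  Membership in an element of the algebra depends only on \<open>\<sigma> p\<close> below some \<open>\<alpha>\<close> and on finitely many bits of
  \<open>\<tau> p\<close>: this holds for the generators, and it passes to Boolean combinations because two conditions
  of this kind have a common refinement. So each point of an element lies in a rectangular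
  cylinder inside that element.
\<close>

lemma determined:
  assumes "a \<in> alg"
  obtains \<alpha> n where "\<alpha> \<in> W" "\<And>p q. p \<in> a \<Longrightarrow> q \<in> cyl \<alpha> (\<sigma> p) n (\<tau> p) \<Longrightarrow> q \<in> a"
proof -
  define agree where "agree = (\<lambda>\<alpha> n p q.
    \<sigma> p \<inter> below \<alpha> = \<sigma> q \<inter> below \<alpha> \<and> \<tau> p \<inter> {..<n} = \<tau> q \<inter> {..<n :: nat})"
  define D where "D = (\<lambda>a \<alpha> n. \<alpha> \<in> W \<and> (\<forall>p q. agree \<alpha> n p q \<longrightarrow> (p \<in> a \<longleftrightarrow> q \<in> a)))"
  obtain w where w: "w \<in> W" using bound[of "{}"] by auto
  have D_mono: "D a \<beta> m" if "D a \<alpha> n" "\<beta> \<in> W" "below \<alpha> \<subseteq> below \<beta>" "n \<le> m" for a \<alpha> \<beta> n m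
    unfolding D_def
  proof (intro conjI allI impI)
    fix p q assume *: "agree \<beta> m p q"
    have "agree \<alpha> n p q"
      unfolding agree_def
    proof
      show "\<sigma> p \<inter> below \<alpha> = \<sigma> q \<inter> below \<alpha>"
        by (rule Int_eq_Int_mono[OF _ that(3)]) (use * in \<open>simp add: agree_def\<close>)
      show "\<tau> p \<inter> {..<n} = \<tau> q \<inter> {..<n}"
        by (rule Int_eq_Int_mono[of _ "{..<m}"]) (use * that(4) in \<open>simp_all add: agree_def\<close>)
    qed
    then show "p \<in> a \<longleftrightarrow> q \<in> a" using that(1) unfolding D_def by blast
  qed (rule that(2))
  have joint: "\<exists>\<gamma> k. D a \<gamma> k \<and> D b \<gamma> k" if ab: "D a \<alpha> n" "D b \<beta> m" for a b \<alpha> \<beta> n m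
  proof -
    have W: "\<alpha> \<in> W" "\<beta> \<in> W" using ab by (auto simp: D_def)
    obtain \<gamma> where "\<gamma> \<in> W" "below \<alpha> \<subseteq> below \<gamma>" "below \<beta> \<subseteq> below \<gamma>"
      using linear[OF W] W by blast
    then have "D a \<gamma> (max n m) \<and> D b \<gamma> (max n m)"
      using ab by (auto intro: D_mono)
    then show ?thesis by blast
  qed
  have "boolean_subalgebra {a. \<exists>\<alpha> n. D a \<alpha> n}"
    unfolding boolean_subalgebra_def
  proof (intro conjI ballI)
    show "bot \<in> {a. \<exists>\<alpha> n. D a \<alpha> n}" "top \<in> {a. \<exists>\<alpha> n. D a \<alpha> n}"
      using w by (auto simp: D_def)
  next
    fix a assume "a \<in> {a. \<exists>\<alpha> n. D a \<alpha> n}"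
    then show "- a \<in> {a. \<exists>\<alpha> n. D a \<alpha> n}" by (simp add: D_def)
  next
    fix a b assume "a \<in> {a. \<exists>\<alpha> n. D a \<alpha> n}" "b \<in> {a. \<exists>\<alpha> n. D a \<alpha> n}"
    then obtain \<gamma> k where *: "D a \<gamma> k" "D b \<gamma> k" using joint by blast
    have "D (inf a b) \<gamma> k" "D (sup a b) \<gamma> k" using * unfolding D_def by blast+
    then show "inf a b \<in> {a. \<exists>\<alpha> n. D a \<alpha> n}" "sup a b \<in> {a. \<exists>\<alpha> n. D a \<alpha> n}" by blast+
  qed
  moreover have "(\<Union>k. gens k) \<subseteq> {a. \<exists>\<alpha> n. D a \<alpha> n}"
  proof (intro UN_least subsetI)
    fix k a assume a: "a \<in> gens k"
    show "a \<in> {a. \<exists>\<alpha> n. D a \<alpha> n}"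
    proof (cases k)
      case 0
      then obtain \<alpha> S where "\<alpha> \<in> W" "a = seg \<alpha> S" using a by (auto simp: gens_def)
      then have "D a \<alpha> 0" by (auto simp: D_def agree_def seg_def)
      then show ?thesis by blast
    next
      case (Suc n)
      then have "a = bit n" using a by (simp add: gens_def)
      then have "D a w (Suc n)" using w by (auto simp: D_def agree_def bit_def)
      then show ?thesis by blast
    qed
  qed
  ultimately have "alg \<subseteq> {a. \<exists>\<alpha> n. D a \<alpha> n}"
    unfolding alg_def by (intro hull_minimal)
  then obtain \<alpha> n where "D a \<alpha> n" using assms by blast
  moreover have "agree \<alpha> n p q" if "q \<in> cyl \<alpha> (\<sigma> p) n (\<tau> p)" for p q
    using that by (simp add: agree_def cyl_def seg_def)
  ultimately have "\<alpha> \<in> W" "\<And>p q. p \<in> a \<Longrightarrow> q \<in> cyl \<alpha> (\<sigma> p) n (\<tau> p) \<Longrightarrow> q \<in> a"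
    unfolding D_def by blast+
  then show thesis by (rule that)
qed

lemma weakly_Radon_Nikodym_alg: "weakly_Radon_Nikodym alg"
  unfolding weakly_Radon_Nikodym_def
proof (intro conjI exI[of _ gens] allI notI)
  show "boolean_subalgebra alg" by (rule boolean_alg)
  show "gens n \<subseteq> alg" for n by (rule gens_alg)
  show "generated_subalgebra (\<Union>n. gens n) = alg" by (simp add: alg_def)
  fix n assume "\<exists>s :: nat \<Rightarrow> 'p set. range s \<subseteq> gens n \<and> independent_family UNIV s"
  then obtain s :: "nat \<Rightarrow> 'p set" where s: "range s \<subseteq> gens n" "independent_family UNIV s" by blast
  have nz: "s 0 \<inter> s 1 \<noteq> {}" "s 0 \<inter> - s 1 \<noteq> {}" "s 1 \<inter> - s 0 \<noteq> {}"
    using independent_family_pair[OF s(2), of 0 1] independent_family_pair[OF s(2), of 1 0]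
    by simp_all
  show False
  proof (cases n)
    case 0
    then have "s 0 \<in> gens 0" "s 1 \<in> gens 0" using s(1) by auto
    then obtain \<alpha> S \<beta> S' where *: "\<alpha> \<in> W" "s 0 = seg \<alpha> S" "\<beta> \<in> W" "s 1 = seg \<beta> S'"
      by (auto simp: gens_def)
    have tree: "seg \<gamma> U \<subseteq> seg \<delta> V" if meet: "seg \<gamma> U \<inter> seg \<delta> V \<noteq> {}" and le: "below \<delta> \<subseteq> below \<gamma>" for \<gamma> \<delta> U V
    proof
      fix q assume q: "q \<in> seg \<gamma> U"
      obtain p where p: "p \<in> seg \<gamma> U" "p \<in> seg \<delta> V" using meet by blast
      have "\<sigma> q \<inter> below \<gamma> = \<sigma> p \<inter> below \<gamma>" using p(1) q by (simp add: seg_def)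
      then have "\<sigma> q \<inter> below \<delta> = \<sigma> p \<inter> below \<delta>" by (rule Int_eq_Int_mono) (rule le)
      then show "q \<in> seg \<delta> V" using p(2) by (simp add: seg_def)
    qed
    show False using linear[OF *(1,3)] tree nz unfolding *(2,4) by blast
  next
    case (Suc m)
    then have "\<And>i. s i = bit m" using s(1) by (simp add: gens_def image_subset_iff)
    then have "s 0 = s 1" by simp
    then show False using nz by blast
  qed
qed

text \<open>
  The successor step of the recursion in the next lemma. The new index \<open>\<beta>\<close> lies strictly above \<open>\<alpha>\<close>, so that
  the first coordinate becomes strictly narrower.
\<close>

lemma cyl_contains_tree_element:
  assumes T: "dense_tree alg T" and \<alpha>: "\<alpha> \<in> W" and S: "countable S"
  obtains \<beta> S' t n' F' where "\<beta> \<in> W" "countable S'" "\<alpha> \<in> below \<beta>" "below \<alpha> \<subseteq> below \<beta>"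
    "S' \<inter> below \<alpha> = S \<inter> below \<alpha>" "t \<in> T" "t \<subseteq> cyl \<alpha> S n F" "cyl \<beta> S' n' F' \<subseteq> t"
proof -
  obtain p0 where "\<sigma> p0 = S" "\<tau> p0 = F" using point[OF S] by blast
  then have "cyl \<alpha> S n F \<noteq> bot" by (auto simp: cyl_def seg_def)
  then obtain t where t: "t \<in> T" "t \<subseteq> cyl \<alpha> S n F"
    using dense_treeD(4)[OF T cyl_alg[OF \<alpha>]] by blast
  have "t \<in> alg" "t \<noteq> {}" using dense_treeD(1,2)[OF T t(1)] by simp_all
  then obtain p where p: "p \<in> t" by blast
  obtain \<alpha>' n' where D: "\<alpha>' \<in> W" "\<And>p q. p \<in> t \<Longrightarrow> q \<in> cyl \<alpha>' (\<sigma> p) n' (\<tau> p) \<Longrightarrow> q \<in> t"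
    using determined[OF \<open>t \<in> alg\<close>] by blast
  obtain \<beta> where \<beta>: "\<beta> \<in> W" "\<alpha> \<in> below \<beta>" "below \<alpha> \<subseteq> below \<beta>" "below \<alpha>' \<subseteq> below \<beta>"
    using bound[of "{\<alpha>, \<alpha>'}"] \<alpha> D(1) by auto
  have "cyl \<beta> (\<sigma> p) n' (\<tau> p) \<subseteq> cyl \<alpha>' (\<sigma> p) n' (\<tau> p)"
  proof
    fix q assume q: "q \<in> cyl \<beta> (\<sigma> p) n' (\<tau> p)"
    have "\<sigma> q \<inter> below \<alpha>' = \<sigma> p \<inter> below \<alpha>'"
      by (rule Int_eq_Int_mono[OF _ \<beta>(4)]) (use q in \<open>simp add: cyl_def seg_def\<close>)
    then show "q \<in> cyl \<alpha>' (\<sigma> p) n' (\<tau> p)" using q by (simp add: cyl_def seg_def)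
  qed
  then have "cyl \<beta> (\<sigma> p) n' (\<tau> p) \<subseteq> t" using D(2)[OF p] by blast
  moreover have "p \<in> cyl \<alpha> S n F" using p t(2) by blast
  then have "\<sigma> p \<inter> below \<alpha> = S \<inter> below \<alpha>"
    by (simp add: cyl_def seg_def)
  ultimately show thesis
    using that[OF \<beta>(1) countable_\<sigma> \<beta>(2,3) _ t] by simp
qed

lemma no_dense_tree: "\<not> dense_tree alg T"
proof
  assume T: "dense_tree alg T"
  \<comment> \<open>The pairs \<open>(len k, word k)\<close> run through all lengths and finite sets, so that step \<open>k\<close> works
    below a prescribed word.\<close>
  define len where "len = (\<lambda>k. fst (prod_decode k))"
  define word where "word = (\<lambda>k. set_decode (snd (prod_decode k)))"
  define good where "good = (\<lambda>x :: 'w \<times> 'w set. fst x \<in> W \<and> countable (snd x))"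
  define step where "step = (\<lambda>k (x :: 'w \<times> 'w set) (y :: 'w \<times> 'w set).
     fst x \<in> below (fst y) \<and> below (fst x) \<subseteq> below (fst y) \<and>
     snd y \<inter> below (fst x) = snd x \<inter> below (fst x) \<and>
     (\<exists>t\<in>T. \<exists>n F. t \<subseteq> cyl (fst x) (snd x) (len k) (word k) \<and> cyl (fst y) (snd y) n F \<subseteq> t))"
  have "\<exists>f. \<forall>k. good (f k) \<and> step k (f k) (f (Suc k))"
  proof (rule dependent_nat_choice)
    obtain w where "w \<in> W" using bound[of "{}"] by auto
    then show "\<exists>x. good x" by (auto simp: good_def intro!: exI[of _ "(w, {})"])
  next
    fix x k assume x: "good x"
    then obtain \<beta> S' t n' F' where "\<beta> \<in> W" "countable S'" "fst x \<in> below \<beta>" "below (fst x) \<subseteq> below \<beta>"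
      "S' \<inter> below (fst x) = snd x \<inter> below (fst x)" "t \<in> T"
      "t \<subseteq> cyl (fst x) (snd x) (len k) (word k)" "cyl \<beta> S' n' F' \<subseteq> t"
      using cyl_contains_tree_element[OF T] unfolding good_def by metis
    then have "good (\<beta>, S') \<and> step k x (\<beta>, S')"
      unfolding good_def step_def by auto
    then show "\<exists>y. good y \<and> step k x y" by blast
  qed
  then obtain f where f: "\<And>k. good (f k)" "\<And>k. step k (f k) (f (Suc k))" by blast
  define \<alpha> where "\<alpha> = (\<lambda>k. fst (f k))"
  define S where "S = (\<lambda>k. snd (f k))"
  have \<alpha>W: "\<alpha> k \<in> W" and S_countable: "countable (S k)" for k
    using f(1) by (auto simp: good_def \<alpha>_def S_def)
  have up: "below (\<alpha> k) \<subseteq> below (\<alpha> (Suc k))" "S (Suc k) \<inter> below (\<alpha> k) = S k \<inter> below (\<alpha> k)" for k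
    using f(2)[of k] by (auto simp: step_def \<alpha>_def S_def)
  have coherent: "below (\<alpha> k) \<subseteq> below (\<alpha> (k + i)) \<and> S (k + i) \<inter> below (\<alpha> k) = S k \<inter> below (\<alpha> k)" for k i
  proof (induction i)
    case (Suc i)
    then show ?case using up[of "k + i"] by auto
  qed simp
  \<comment> \<open>The limit of the sequence; here countable closure of the first factor is used.\<close>
  define S\<omega> where "S\<omega> = (\<Union>k. S k \<inter> below (\<alpha> k))"
  have S\<omega>: "S\<omega> \<inter> below (\<alpha> k) = S k \<inter> below (\<alpha> k)" for k
  proof -
    have "S i \<inter> below (\<alpha> i) \<inter> below (\<alpha> k) \<subseteq> S k" for i
    proof (cases "i \<le> k")
      case True
      then show ?thesis using coherent[of i "k - i"] by auto
    next
      case False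
      then show ?thesis using coherent[of k "i - k"] by auto
    qed
    then show ?thesis by (auto simp: S\<omega>_def)
  qed
  have "countable S\<omega>" unfolding S\<omega>_def using S_countable by auto
  obtain \<alpha>\<omega> where \<alpha>\<omega>: "\<alpha>\<omega> \<in> W" "\<And>k. \<alpha> k \<in> below \<alpha>\<omega>" "\<And>k. below (\<alpha> k) \<subseteq> below \<alpha>\<omega>"
  proof -
    have "countable (range \<alpha>)" "range \<alpha> \<subseteq> W" using \<alpha>W by auto
    from bound[OF this] show thesis using that by auto
  qed
  \<comment> \<open>A tree element \<open>t\<close> over the limit. Nothing is prescribed in the second coordinate; \<open>F\<close> is the word of
    length \<open>n\<close> over which \<open>t\<close> contains a full cylinder.\<close>
  obtain \<beta> S' t n F where "cyl \<beta> S' n F \<subseteq> t" and "countable S'" and t: "t \<in> T" "t \<subseteq> cyl \<alpha>\<omega> S\<omega> 0 {}"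
    using cyl_contains_tree_element[OF T \<alpha>\<omega>(1) \<open>countable S\<omega>\<close>] by metis
  have t_sub: "t \<subseteq> seg \<alpha>\<omega> S\<omega>" using t(2) by (auto simp: cyl_def)
  obtain p where p: "\<sigma> p = S'" "\<tau> p = F" using point[OF \<open>countable S'\<close>] by blast
  have in_t: "q \<in> t" if "\<sigma> q = S'" "\<tau> q \<inter> {..<n} = F \<inter> {..<n}" for q
  proof -
    have "q \<in> cyl \<beta> S' n F" using that by (simp add: cyl_def seg_def)
    then show ?thesis using \<open>cyl \<beta> S' n F \<subseteq> t\<close> by blast
  qed
  have S'_below: "S' \<inter> below (\<alpha> k) = S k \<inter> below (\<alpha> k)" for k
  proof -
    have "p \<in> seg \<alpha>\<omega> S\<omega>" using in_t[OF p(1)] p(2) t_sub by auto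
    then have "S' \<inter> below \<alpha>\<omega> = S\<omega> \<inter> below \<alpha>\<omega>" using p(1) by (simp add: seg_def)
    then have "S' \<inter> below (\<alpha> k) = S\<omega> \<inter> below (\<alpha> k)"
      by (rule Int_eq_Int_mono) (rule \<alpha>\<omega>(3))
    also have "\<dots> = S k \<inter> below (\<alpha> k)" by (rule S\<omega>)
    finally show ?thesis .
  qed
  \<comment> \<open>The step that treated the one-bit extension of this word by the bit \<open>n\<close>, set to one.\<close>
  define k where "k = prod_encode (Suc n, set_encode (insert n (F \<inter> {..<n})))"
  have k: "len k = Suc n" "word k = insert n (F \<inter> {..<n})"
    by (simp_all add: k_def len_def word_def set_encode_inverse del: set_encode_insert)
  obtain u m G where u: "u \<in> T" "u \<subseteq> cyl (\<alpha> k) (S k) (len k) (word k)"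
    "cyl (\<alpha> (Suc k)) (S (Suc k)) m G \<subseteq> u"
    using f(2)[of k] unfolding step_def \<alpha>_def S_def by blast
  have in_u: "q \<in> u" if "\<sigma> q \<inter> below (\<alpha> (Suc k)) = S (Suc k) \<inter> below (\<alpha> (Suc k))" "\<tau> q = G" for q
  proof -
    have "q \<in> cyl (\<alpha> (Suc k)) (S (Suc k)) m G" using that by (simp add: cyl_def seg_def)
    then show ?thesis using u(3) by blast
  qed
  have u_word: "\<tau> q \<inter> {..<Suc n} = insert n (F \<inter> {..<n})" if "q \<in> u" for q
  proof -
    have "q \<in> cyl (\<alpha> k) (S k) (len k) (word k)" using u(2) that by blast
    then have "\<tau> q \<inter> {..<Suc n} = insert n (F \<inter> {..<n}) \<inter> {..<Suc n}" by (simp add: cyl_def k)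
    also have "\<dots> = insert n (F \<inter> {..<n})" by auto
    finally show ?thesis .
  qed
  have "t \<inter> u \<noteq> {}"
  proof -
    obtain q where q: "\<sigma> q = S'" "\<tau> q = G" using point[OF \<open>countable S'\<close>] by blast
    have "q \<in> u" using in_u q S'_below by blast
    moreover have "q \<in> t"
    proof (rule in_t[OF q(1)])
      have "\<tau> q \<inter> {..<n} = (\<tau> q \<inter> {..<Suc n}) \<inter> {..<n}" by auto
      also have "\<dots> = F \<inter> {..<n}" unfolding u_word[OF \<open>q \<in> u\<close>] by auto
      finally show "\<tau> q \<inter> {..<n} = F \<inter> {..<n}" .
    qed
    ultimately show ?thesis by blast
  qed
  moreover have "\<not> t \<subseteq> u"
  proof -
    obtain q where q: "\<sigma> q = S'" "\<tau> q = F \<inter> {..<n}" using point[OF \<open>countable S'\<close>] by blast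
    have "q \<in> t" using in_t q by auto
    moreover have "q \<notin> u" using u_word[of q] q(2) by auto
    ultimately show ?thesis by blast
  qed
  moreover have "\<not> u \<subseteq> t"
  proof -
    \<comment> \<open>\<open>u\<close> contains a cylinder that leaves the first coordinate free at \<open>\<alpha> (Suc k)\<close>, but all of \<open>t\<close>
      agrees there with the limit; \<open>?V\<close> is chosen to disagree.\<close>
    let ?a = "\<alpha> (Suc k)"
    let ?V = "(S (Suc k) \<inter> below ?a) \<union> ({?a} - S\<omega>)"
    have "countable ?V" using S_countable by (intro countable_Un countable_Int1) auto
    then obtain q where q: "\<sigma> q = ?V" "\<tau> q = G" using point by blast
    have "q \<in> u" using in_u q irrefl[of ?a] by auto
    moreover have "q \<notin> seg \<alpha>\<omega> S\<omega>"
      using q(1) \<alpha>\<omega>(2)[of "Suc k"] irrefl[of ?a] by (auto simp: seg_def)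
    ultimately show ?thesis using t_sub by blast
  qed
  ultimately show False
    using dense_treeD(3)[OF T t(1) u(1)] by simp
qed

end

section \<open>Coding by real numbers\<close>

text \<open>
  A real codes a set of natural numbers, which is cut into countably many rows. Row \<open>0\<close> is the
  second coordinate; the other rows list the members of the countable set. A member \<open>w\<close> is listed as
  \<open>insert 0 (Suc ` w)\<close>, so that a row without \<open>0\<close> lists nothing and the empty set gets a code, too.
\<close>

lemma coding_of_countable_sets:
  obtains \<sigma> :: "real \<Rightarrow> nat set set" and \<tau> :: "real \<Rightarrow> nat set"
  where "\<And>u. countable (\<sigma> u)" "\<And>S F. countable S \<Longrightarrow> \<exists>u. \<sigma> u = S \<and> \<tau> u = F"
proof -
  obtain h :: "real \<Rightarrow> nat set" where h: "bij h"
    using eqpoll_sym[OF nat_sets_eqpoll_reals] unfolding eqpoll_def by auto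
  define row where "row = (\<lambda>u k. {i. prod_encode (k, i) \<in> h u})"
  have row: "\<exists>u. \<forall>k. row u k = f k" for f :: "nat \<Rightarrow> nat set"
  proof -
    let ?X = "{c. snd (prod_decode c) \<in> f (fst (prod_decode c))}"
    have "h (inv h ?X) = ?X" using h by (simp add: bij_is_surj surj_f_inv_f)
    then have "row (inv h ?X) k = f k" for k by (simp add: row_def)
    then show ?thesis by (intro exI allI)
  qed
  define \<sigma> where "\<sigma> = (\<lambda>u. {w. \<exists>k. row u (Suc k) = insert 0 (Suc ` w)})"
  show thesis
  proof (rule that[of \<sigma> "\<lambda>u. row u 0"])
    fix u
    have "\<sigma> u \<subseteq> range (\<lambda>k. {i. Suc i \<in> row u (Suc k)})"
    proof
      fix w assume "w \<in> \<sigma> u"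
      then obtain k where "row u (Suc k) = insert 0 (Suc ` w)" by (auto simp: \<sigma>_def)
      then have "w = {i. Suc i \<in> row u (Suc k)}" by auto
      then show "w \<in> range (\<lambda>k. {i. Suc i \<in> row u (Suc k)})" by blast
    qed
    then show "countable (\<sigma> u)" by (rule countable_subset) simp
  next
    fix S :: "nat set set" and F :: "nat set" assume S: "countable S"
    define f where "f = (\<lambda>k. case k of 0 \<Rightarrow> F | Suc k \<Rightarrow>
      if S = {} then {} else insert 0 (Suc ` from_nat_into S k))"
    obtain u where u: "\<forall>k. row u k = f k" using row by blast
    have inj: "insert 0 (Suc ` v) = insert 0 (Suc ` w) \<longleftrightarrow> v = w" for v w
      by (auto dest: equalityD1 equalityD2)
    have "\<sigma> u = S"
    proof (cases "S = {}")
      case False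
      then have "\<sigma> u = range (from_nat_into S)"
        using u by (auto simp: \<sigma>_def f_def inj)
      then show ?thesis using False S by simp
    qed (use u in \<open>auto simp: \<sigma>_def f_def\<close>)
    moreover have "row u 0 = F" using u by (simp add: f_def)
    ultimately show "\<exists>u. \<sigma> u = S \<and> row u 0 = F" by blast
  qed
qed

text \<open>
  This is \<open>\<omega>\<^sub>1\<close>, realised as the elements with countably many predecessors in a well-order of an uncountable
  type. The least element outside the countable initial segment generated by \<open>S\<close> has countably many
  predecessors, hence belongs to \<open>W\<close>, and bounds \<open>S\<close> strictly.
\<close>

lemma countably_directed_linear_order:
  obtains W :: "nat set set" and below :: "nat set \<Rightarrow> nat set set"
  where "\<And>\<alpha>. \<alpha> \<notin> below \<alpha>"
    "\<And>\<alpha> \<beta>. below \<alpha> \<subseteq> below \<beta> \<or> below \<beta> \<subseteq> below \<alpha>"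
    "\<And>S. countable S \<Longrightarrow> S \<subseteq> W \<Longrightarrow> \<exists>\<beta>\<in>W. S \<subseteq> below \<beta> \<and> (\<forall>\<alpha>\<in>S. below \<alpha> \<subseteq> below \<beta>)"
proof -
  obtain r :: "nat set rel" where r: "well_order_on UNIV r"
    using well_order_on by blast
  then have R: "Well_order r" "Field r = UNIV"
    using well_order_on_Well_order by blast+
  interpret wo_rel r by (rule wo_rel.intro[OF R(1)])
  have total: "(a, b) \<in> r \<or> (b, a) \<in> r" for a b
    using TOTALS R(2) by blast
  have tr: "(a, c) \<in> r" if "(a, b) \<in> r" "(b, c) \<in> r" for a b c
    using TRANS that by (meson transD)
  have anti: "a = b" if "(a, b) \<in> r" "(b, a) \<in> r" for a b
    using ANTISYM that by (meson antisymD)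
  have mono: "underS a \<subseteq> underS b" if "(a, b) \<in> r" for a b
    using that tr anti unfolding Order_Relation.underS_def by blast
  show thesis
  proof (rule that[of underS "{x. countable (underS x)}"])
    show "a \<notin> underS a" for a by (simp add: Order_Relation.underS_def)
    show "underS a \<subseteq> underS b \<or> underS b \<subseteq> underS a" for a b
      using total mono by blast
    fix S assume S: "countable S" "S \<subseteq> {x. countable (underS x)}"
    define U where "U = (\<Union>a\<in>S. insert a (underS a))"
    have "countable U" using S by (auto simp: U_def)
    have "uncountable (UNIV :: nat set set)"
      using countable_eqpoll[OF _ eqpoll_sym[OF nat_sets_eqpoll_reals]] uncountable_UNIV_real
      by blast
    then have "U \<noteq> UNIV" using \<open>countable U\<close> by auto
    then obtain d where "d \<notin> U" by blast
    moreover have "wf (r - Id)" using r by (simp add: well_order_on_def)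
    ultimately obtain b where b: "b \<notin> U" "\<forall>c. (c, b) \<in> r - Id \<longrightarrow> c \<in> U"
      unfolding wf_eq_minimal by (metis ComplD ComplI)
    have "underS b \<subseteq> U" using b(2) by (auto simp: Order_Relation.underS_def)
    then have "countable (underS b)" using \<open>countable U\<close> countable_subset by blast
    moreover have "(a, b) \<in> r" "a \<in> underS b" if "a \<in> S" for a
    proof -
      have "(b, a) \<notin> r" "a \<noteq> b" using b(1) that by (auto simp: U_def Order_Relation.underS_def)
      then show "(a, b) \<in> r" "a \<in> underS b"
        using total[of a b] by (auto simp: Order_Relation.underS_def)
    qed
    ultimately show "\<exists>b\<in>{x. countable (underS x)}.
        S \<subseteq> underS b \<and> (\<forall>a\<in>S. underS a \<subseteq> underS b)"
      using mono by blast
  qed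
qed

theorem mainTheorem2:
  shows "\<exists>A :: real set set.
           boolean_subalgebra A \<and> weakly_Radon_Nikodym A \<and> \<not> minimally_generated A"
proof (rule coding_of_countable_sets)
  fix \<sigma> :: "real \<Rightarrow> nat set set" and \<tau> :: "real \<Rightarrow> nat set"
  assume code: "\<And>u. countable (\<sigma> u)" "\<And>S F. countable S \<Longrightarrow> \<exists>u. \<sigma> u = S \<and> \<tau> u = F"
  show ?thesis
  proof (rule countably_directed_linear_order)
    fix W :: "nat set set" and below :: "nat set \<Rightarrow> nat set set"
    assume order: "\<And>\<alpha>. \<alpha> \<notin> below \<alpha>"
      "\<And>\<alpha> \<beta>. below \<alpha> \<subseteq> below \<beta> \<or> below \<beta> \<subseteq> below \<alpha>"
      "\<And>S. countable S \<Longrightarrow> S \<subseteq> W \<Longrightarrow> \<exists>\<beta>\<in>W. S \<subseteq> below \<beta> \<and> (\<forall>\<alpha>\<in>S. below \<alpha> \<subseteq> below \<beta>)"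
    interpret tree_times_cantor W below \<sigma> \<tau>
      by unfold_locales (rule order code; assumption)+
    show ?thesis
    proof (intro exI conjI notI)
      show "boolean_subalgebra alg" by (rule boolean_alg)
      show "weakly_Radon_Nikodym alg" by (rule weakly_Radon_Nikodym_alg)
      assume "minimally_generated alg"
      then obtain T where "dense_tree alg T" by (rule minimally_generated_dense_tree)
      then show False using no_dense_tree by blast
    qed
  qed
qed

end
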